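(* Let $\lambda>0$ and let $Z^\lambda$ denote the set of solutions to $\min_{q\in(\Delta(A\times B))^S}\mathcal{L}(q,\lambda)$. Given $q^0\in\mathrm{ri}\big((\Delta(A\times B))^S\big)$ (relative interior), consider the sequence $(q^n)_{n\in\mathbb{N}}$ generated by the recurrence $$(\forall n\in\mathbb{N})(\forall s\in S)(\forall(a,b)\in A\times B)\quad q_{ab}^{n+1,s}=\frac{(T(q^n))_b\,e^{-c_{ab}^s/\lambda}}{\sum_{a'\in A}\sum_{b'\in B}(T(q^n))_{b'}\,e^{-c_{a'b'}^s/\lambda}},$$ where $T:(\Delta(A\times B))^S\to\Delta(B)$ is defined by $$T(q)=\Big(\sum_{s\in S}p_s\sum_{a\in A}q_{ab}^s\Big)_{b\in B}.$$ Then there is some $\overline{q}\in Z^\lambda$ such that $q^n\to\overline{q}$ and $\mathcal{L}(q^n,\lambda)-\mathcal{L}(\overline{q},\lambda)=O(1/n)$.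
   Context: $A,B,S$ are nonempty finite sets with $|A|\ge2$, $(c_{ab}^s)_{a\in A,b\in B,s\in S}$ are real cost values, and $p=(p_s)_{s\in S}$ is a probability distribution on $S$ with $p_s>0$ for all $s$. For a nonempty finite set $I$, $\Delta(I)=\{x\in[0,1]^I:\sum_{i\in I}x_i=1\}$. Elements $q\in(\Delta(A\times B))^S$ have components $q_{ab}^s$; the components of $q^n$ are written $q_{ab}^{n,s}$. For $s\in S$, $c_{\min}^s=\min_{(a,b)}c_{ab}^s$ and $c_{\max}^s=\max_{(a,b)}c_{ab}^s$; $c_{\min}=\sum_sp_sc_{\min}^s$ and $c_{\max}=\sum_sp_sc_{\max}^s$. Standing assumption: $c_{\min}^s=0$ for all $s\in S$, and $c_{\max}>c_{\min}$. Define $\psi:\mathbb{R}^2\to\,]-\infty,+\infty]$ by $\psi(\xi,\mu)=\xi\ln(\xi/\mu)$ if $\xi>0$ and $\mu>0$; $\psi(0,\mu)=0$ if $\mu\ge0$; and $+\infty$ otherwise. The function $g:(\mathbb{R}^{A\times B})^S\to\,]-\infty,+\infty]$ is $$g(q)=\sum_{s\in S}p_s\sum_{a\in A}\sum_{b\in B}\psi\Big(q_{ab}^s,\sum_{a'\in A}\sum_{s'\in S}p_{s'}q_{a'b}^{s'}\Big)$$ if all components of $q$ are nonnegative, and $g(q)=+\infty$ otherwise. The Lagrangian is $\mathcal{L}(q,\lambda)=\sum_{s\in S}p_s\sum_{a\in A}\sum_{b\in B}c_{ab}^sq_{ab}^s+\lambda g(q)$. *)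

theory Defs
  imports "HOL-Analysis.Analysis" "HOL-Library.Landau_Symbols"
begin

text \<open>The nonempty finite sets A, B, S are the universes of finite types.  An element of
  the product over S of the copies of the space of real families on A x B is a vector
  \<open>q :: real ^ ('a \<times> 'b) ^ 's\<close>, and \<open>q $ s $ (a, b)\<close> is the component
  with lower indices a, b and upper index s.\<close>

definition simplex_on :: "(real ^ 'i) set" where
  "simplex_on = {x. (\<forall>i. 0 \<le> x $ i \<and> x $ i \<le> 1) \<and> (\<Sum>i\<in>UNIV. x $ i) = 1}"

definition simplex_family :: "(real ^ 'i ^ 's) set" where
  "simplex_family = {q. \<forall>s. q $ s \<in> simplex_on}"

definition cost_min_at :: "('a::finite \<Rightarrow> 'b::finite \<Rightarrow> 's \<Rightarrow> real) \<Rightarrow> 's \<Rightarrow> real" where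
  "cost_min_at c s = Min (range (\<lambda>(a, b). c a b s))"

definition cost_max_at :: "('a::finite \<Rightarrow> 'b::finite \<Rightarrow> 's \<Rightarrow> real) \<Rightarrow> 's \<Rightarrow> real" where
  "cost_max_at c s = Max (range (\<lambda>(a, b). c a b s))"

definition cost_min ::
  "('s::finite \<Rightarrow> real) \<Rightarrow> ('a::finite \<Rightarrow> 'b::finite \<Rightarrow> 's \<Rightarrow> real) \<Rightarrow> real" where
  "cost_min p c = (\<Sum>s\<in>UNIV. p s * cost_min_at c s)"

definition cost_max ::
  "('s::finite \<Rightarrow> real) \<Rightarrow> ('a::finite \<Rightarrow> 'b::finite \<Rightarrow> 's \<Rightarrow> real) \<Rightarrow> real" where
  "cost_max p c = (\<Sum>s\<in>UNIV. p s * cost_max_at c s)"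

definition psi :: "real \<Rightarrow> real \<Rightarrow> ereal" where
  "psi \<xi> \<mu> =
    (if \<xi> > 0 \<and> \<mu> > 0 then ereal (\<xi> * ln (\<xi> / \<mu>))
     else if \<xi> = 0 \<and> \<mu> \<ge> 0 then 0
     else \<infinity>)"

definition g_fun ::
  "('s::finite \<Rightarrow> real) \<Rightarrow> real ^ ('a::finite \<times> 'b::finite) ^ 's \<Rightarrow> ereal" where
  "g_fun p q =
    (if \<forall>s a b. 0 \<le> q $ s $ (a, b)
     then (\<Sum>s\<in>UNIV. ereal (p s) * (\<Sum>a\<in>UNIV. \<Sum>b\<in>UNIV.
            psi (q $ s $ (a, b)) (\<Sum>a'\<in>UNIV. \<Sum>s'\<in>UNIV. p s' * q $ s' $ (a', b))))
     else \<infinity>)"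

definition lagrangian ::
  "('s::finite \<Rightarrow> real) \<Rightarrow> ('a::finite \<Rightarrow> 'b::finite \<Rightarrow> 's \<Rightarrow> real)
    \<Rightarrow> real ^ ('a \<times> 'b) ^ 's \<Rightarrow> real \<Rightarrow> ereal" where
  "lagrangian p c q lam =
    ereal (\<Sum>s\<in>UNIV. p s * (\<Sum>a\<in>UNIV. \<Sum>b\<in>UNIV. c a b s * q $ s $ (a, b)))
    + ereal lam * g_fun p q"

definition minimizers ::
  "('s::finite \<Rightarrow> real) \<Rightarrow> ('a::finite \<Rightarrow> 'b::finite \<Rightarrow> 's \<Rightarrow> real)
    \<Rightarrow> real \<Rightarrow> (real ^ ('a \<times> 'b) ^ 's) set" where
  "minimizers p c lam =
    {q. is_arg_min (\<lambda>q. lagrangian p c q lam) (\<lambda>q. q \<in> simplex_family) q}"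

definition T_map ::
  "('s::finite \<Rightarrow> real) \<Rightarrow> real ^ ('a::finite \<times> 'b::finite) ^ 's \<Rightarrow> real ^ 'b" where
  "T_map p q = (\<chi> b. \<Sum>s\<in>UNIV. p s * (\<Sum>a\<in>UNIV. q $ s $ (a, b)))"

text \<open>On the feasible set the Lagrangian is finite, so applying \<^const>\<open>real_of_ereal\<close>
  to its values there loses nothing.\<close>

lemma lagrangian_finite:
  fixes p :: "'s::finite \<Rightarrow> real"
    and c :: "'a::finite \<Rightarrow> 'b::finite \<Rightarrow> 's \<Rightarrow> real"
    and q :: "real ^ ('a \<times> 'b) ^ 's"
  assumes p: "\<And>s. p s > 0" and q: "q \<in> simplex_family"
  shows "\<bar>lagrangian p c q lam\<bar> \<noteq> \<infinity>"
proof -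
  have nn: "0 \<le> q $ s $ (a, b)" for s a b
    using q by (auto simp: simplex_family_def simplex_on_def)
  define m where "m b = (\<Sum>a'\<in>UNIV. \<Sum>s'\<in>UNIV. p s' * q $ s' $ (a', b))" for b
  have m0: "0 \<le> m b" for b
    unfolding m_def by (intro sum_nonneg mult_nonneg_nonneg nn less_imp_le[OF p])
  have mpos: "0 < m b" if "0 < q $ s $ (a, b)" for s a b
  proof -
    have "0 < p s * q $ s $ (a, b)" using p that by simp
    also have "\<dots> \<le> (\<Sum>s'\<in>UNIV. p s' * q $ s' $ (a, b))"
      by (rule member_le_sum) (auto intro!: mult_nonneg_nonneg nn less_imp_le[OF p])
    also have "\<dots> \<le> m b"
      unfolding m_def
      by (rule member_le_sum[where f = "\<lambda>a. \<Sum>s'\<in>UNIV. p s' * q $ s' $ (a, b)"])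
        (auto intro!: sum_nonneg mult_nonneg_nonneg nn less_imp_le[OF p])
    finally show ?thesis .
  qed
  have "psi (q $ s $ (a, b)) (m b) = ereal (q $ s $ (a, b) * ln (q $ s $ (a, b) / m b))"
    for s a b
    using nn[of s a b] m0[of b] mpos[of s a b]
    by (cases "q $ s $ (a, b) = 0") (auto simp: psi_def zero_ereal_def)
  then have "g_fun p q = ereal (\<Sum>s\<in>UNIV. p s * (\<Sum>a\<in>UNIV. \<Sum>b\<in>UNIV.
      q $ s $ (a, b) * ln (q $ s $ (a, b) / m b)))"
    using nn unfolding g_fun_def m_def[symmetric] by simp
  then show ?thesis by (simp add: lagrangian_def)
qed

end

theory Submission
  imports Defs
begin

text \<open>Write \<open>F(q, r) = \<Sum>\<^sub>s p\<^sub>s \<Sum> q ln (q / (r e\<^sup>-\<^sup>c\<^sup>/\<^sup>\<lambda>))\<close>. Then the Lagrangian is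
  \<open>\<lambda> F(q, T q)\<close>, and minimizing \<open>F(\<sqdot>, r)\<close> gives \<open>- f(r)\<close> with \<open>f(r) = \<Sum>\<^sub>s p\<^sub>s ln Z\<^sub>s(r)\<close> and
  \<open>Z\<^sub>s\<close> linear in \<open>r\<close>. The marginals \<open>r\<^sup>n = T q\<^sup>n\<close> follow the EM iteration for the weights of a
  finite mixture with log-likelihood \<open>f\<close>. By the log-sum inequality each step raises \<open>f\<close> by at
  least \<open>KL(r\<^sup>n\<^sup>+\<^sup>1, r\<^sup>n)\<close>, so maximizers of \<open>f\<close> are fixed points; and for every maximizer \<open>m\<close>,
  \<open>f(m) - f(r\<^sup>n) \<le> KL(m, r\<^sup>n) - KL(m, r\<^sup>n\<^sup>+\<^sup>1)\<close>. Telescoping yields the rate \<open>O(1/n)\<close>, and since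
  \<open>KL(m, r\<^sup>n)\<close> decreases, it tends to zero when \<open>m\<close> is a cluster point of the iterates.\<close>

section \<open>Simplices and their products: compactness, convexity, relative interior\<close>

lemma compact_simplex_on: "compact (simplex_on :: (real ^ 'i) set)"
proof -
  have "closed (simplex_on :: (real ^ 'i) set)"
    unfolding simplex_on_def
    by (intro closed_Collect_conj closed_Collect_all closed_Collect_le closed_Collect_eq
        continuous_intros)
  moreover have "bounded (simplex_on :: (real ^ 'i) set)"
    by (rule bounded_subset[OF bounded_cbox[of 0 1]])
      (auto simp: simplex_on_def mem_box_cart)
  ultimately show ?thesis by (simp add: compact_eq_bounded_closed)
qed

lemma simplex_onD:
  assumes "x \<in> simplex_on"
  shows "0 \<le> x $ i" "(\<Sum>i\<in>UNIV. x $ i) = 1"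
  using assms by (auto simp: simplex_on_def)

lemma simplex_onI:
  fixes x :: "real ^ 'i"
  assumes "\<And>i. 0 \<le> x $ i" "(\<Sum>i\<in>UNIV. x $ i) = 1"
  shows "x \<in> simplex_on"
proof -
  have "x $ i \<le> 1" for i
    unfolding assms(2)[symmetric] by (rule member_le_sum) (auto intro: assms)
  with assms show ?thesis by (auto simp: simplex_on_def)
qed

lemma uniform_in_simplex_family:
  "(\<chi> s i. 1 / real CARD('i)) \<in> (simplex_family :: (real ^ 'i ^ 's) set)"
  unfolding simplex_family_def by (auto intro!: simplex_onI)

lemma convex_simplex_family: "convex (simplex_family :: (real ^ 'i ^ 's) set)"
  unfolding convex_alt simplex_family_def
  by (auto intro!: simplex_onI add_nonneg_nonneg mult_nonneg_nonneg
      simp: simplex_onD sum.distrib simp flip: sum_distrib_left)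

text \<open>The segment from the uniform family to a relative interior point can be prolonged
  slightly beyond that point within the set. A vanishing coordinate would become negative on the
  prolongation.\<close>

lemma rel_interior_simplex_family_pos:
  fixes q :: "real ^ 'i ^ 's"
  assumes "q \<in> rel_interior simplex_family"
  shows "0 < q $ s $ i"
proof -
  let ?u = "(\<chi> s i. 1 / real CARD('i)) :: real ^ 'i ^ 's"
  obtain e where e: "e > 1" "(1 - e) *\<^sub>R ?u + e *\<^sub>R q \<in> simplex_family"
    using assms convex_rel_interior_iff[OF convex_simplex_family, of q]
      uniform_in_simplex_family by blast
  from e(2) have "0 \<le> ((1 - e) *\<^sub>R ?u + e *\<^sub>R q) $ s $ i"
    unfolding simplex_family_def by (blast intro: simplex_onD)
  then have "(e - 1) * (1 / real CARD('i)) \<le> e * q $ s $ i"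
    by (simp add: left_diff_distrib diff_divide_distrib)
  moreover have "0 < (e - 1) * (1 / real CARD('i))" using e(1) by simp
  ultimately have "0 < e * q $ s $ i" by linarith
  then show ?thesis using e(1) by (simp add: zero_less_mult_iff)
qed

section \<open>Logarithmic inequalities and the Kullback-Leibler divergence\<close>

lemma mult_ln_ratio_ge:
  fixes t u :: real
  assumes "0 \<le> t" "0 \<le> u" "u = 0 \<Longrightarrow> t = 0"
  shows "t - u + (sqrt t - sqrt u)\<^sup>2 \<le> t * ln (t / u)"
proof (cases "t = 0")
  case False
  then have pos: "0 < t" "0 < u" using assms by (auto simp: order_less_le)
  \<comment> \<open>The tangent bound is applied to the square root of the ratio: doubling it gives
    \<open>2 * t - 2 * sqrt (t * u)\<close>, which is exactly \<open>t - u\<close> plus the squared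
    difference of roots.\<close>
  have "ln (sqrt (u / t)) \<le> sqrt (u / t) - 1"
    using pos by (intro ln_le_minus_one) simp
  then have "ln (u / t) \<le> 2 * (sqrt (u / t) - 1)"
    using pos by (simp add: ln_sqrt)
  then have "t * ln (u / t) \<le> t * (2 * (sqrt (u / t) - 1))"
    using pos by (intro mult_left_mono) auto
  moreover have "t * sqrt (u / t) = sqrt t * sqrt u"
    using pos by (simp add: real_sqrt_divide field_simps)
  moreover have "ln (t / u) = - ln (u / t)"
    using pos by (simp add: ln_div)
  ultimately show ?thesis
    using pos by (simp add: power2_diff algebra_simps)
qed (use assms in auto)

lemma log_sum_inequality:
  fixes x y :: "'i \<Rightarrow> real"
  assumes I: "finite I"
    and x: "\<And>i. i \<in> I \<Longrightarrow> 0 \<le> x i"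
    and y: "\<And>i. i \<in> I \<Longrightarrow> 0 \<le> y i"
    and xy: "\<And>i. i \<in> I \<Longrightarrow> y i = 0 \<Longrightarrow> x i = 0"
  shows "sum x I * ln (sum x I / sum y I) \<le> (\<Sum>i\<in>I. x i * ln (x i / y i))"
proof (cases "sum x I = 0")
  case True
  then have "x i = 0" if "i \<in> I" for i
    using that I x by (simp add: sum_nonneg_eq_0_iff)
  then show ?thesis by simp
next
  case False
  define X where "X = sum x I"
  define Y where "Y = sum y I"
  have X: "0 < X" using False x by (simp add: X_def order_less_le sum_nonneg)
  have "Y \<noteq> 0"
    using False I xy y by (metis Y_def sum.neutral sum_nonneg_eq_0_iff)
  then have Y: "0 < Y" using y by (simp add: Y_def order_less_le sum_nonneg)
  \<comment> \<open>Rescaling \<open>y\<close> by \<open>X / Y\<close> gives it the total mass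
    \<open>X\<close>, so the linear terms of the pointwise bound cancel on summation.\<close>
  have "x i - y i * (X / Y) + x i * ln (X / Y) \<le> x i * ln (x i / y i)" if i: "i \<in> I" for i
  proof (cases "x i = 0")
    case True
    with X Y y[OF i] show ?thesis by simp
  next
    case False
    then have pos: "0 < x i" "0 < y i" using x[OF i] y[OF i] xy[OF i] by (auto simp: order_less_le)
    have "x i - y i * (X / Y) \<le> x i * ln (x i / (y i * (X / Y)))"
      using mult_ln_ratio_ge[of "x i" "y i * (X / Y)"] pos X Y
      by (smt (verit) divide_pos_pos mult_pos_pos zero_le_power2)
    moreover have "ln (x i / (y i * (X / Y))) = ln (x i / y i) - ln (X / Y)"
      using pos X Y by (simp add: ln_div ln_mult)
    ultimately show ?thesis by (simp only: right_diff_distrib)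
  qed
  then have "(\<Sum>i\<in>I. x i - y i * (X / Y) + x i * ln (X / Y)) \<le> (\<Sum>i\<in>I. x i * ln (x i / y i))"
    by (rule sum_mono)
  moreover have "(\<Sum>i\<in>I. x i - y i * (X / Y) + x i * ln (X / Y)) = X - Y * (X / Y) + X * ln (X / Y)"
    by (simp only: sum.distrib sum_subtractf sum_distrib_right X_def Y_def)
  ultimately show ?thesis using Y by (simp add: X_def Y_def)
qed

text \<open>The Kullback-Leibler divergence as a real number. A summand with
  \<open>y $ b = 0 < x $ b\<close> takes a finite default value instead of infinity, hence the
  support conditions in the bounds below.\<close>

definition kl_div :: "real ^ 'b \<Rightarrow> real ^ 'b \<Rightarrow> real" where
  "kl_div x y = (\<Sum>b\<in>UNIV. x $ b * ln (x $ b / y $ b))"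

lemma kl_div_self: "kl_div x x = 0"
  by (auto simp: kl_div_def intro: sum.neutral)

text \<open>Both vectors have mass one, so the linear terms of \<open>mult_ln_ratio_ge\<close>
  cancel and only the squared Hellinger-type distance remains. This makes the divergence separate
  points.\<close>

lemma kl_div_ge_hellinger:
  assumes x: "x \<in> simplex_on" and y: "y \<in> simplex_on" and xy: "\<And>b. y $ b = 0 \<Longrightarrow> x $ b = 0"
  shows "(\<Sum>b\<in>UNIV. (sqrt (x $ b) - sqrt (y $ b))\<^sup>2) \<le> kl_div x y"
proof -
  have "(\<Sum>b\<in>UNIV. x $ b - y $ b + (sqrt (x $ b) - sqrt (y $ b))\<^sup>2) \<le> kl_div x y"
    unfolding kl_div_def
    using simplex_onD[OF x] simplex_onD[OF y] xy by (intro sum_mono mult_ln_ratio_ge) auto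
  then show ?thesis using simplex_onD[OF x] simplex_onD[OF y]
    by (simp add: sum.distrib sum_subtractf)
qed

lemma kl_div_nonneg:
  assumes "x \<in> simplex_on" "y \<in> simplex_on" "\<And>b. y $ b = 0 \<Longrightarrow> x $ b = 0"
  shows "0 \<le> kl_div x y"
  using kl_div_ge_hellinger[OF assms] by (meson order_trans sum_nonneg zero_le_power2)

lemma kl_div_tendsto_0_imp_tendsto:
  assumes x: "x \<in> simplex_on" and y: "\<And>n. y n \<in> simplex_on" "\<And>n b. 0 < y n $ b"
    and lim: "(\<lambda>n. kl_div x (y n)) \<longlonglongrightarrow> 0"
  shows "y \<longlonglongrightarrow> x"
proof (rule vec_tendstoI)
  fix b
  have le: "(sqrt (x $ b) - sqrt (y n $ b))\<^sup>2 \<le> kl_div x (y n)" for n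
  proof -
    have "(sqrt (x $ b) - sqrt (y n $ b))\<^sup>2
        \<le> (\<Sum>b\<in>UNIV. (sqrt (x $ b) - sqrt (y n $ b))\<^sup>2)"
      by (rule member_le_sum) auto
    also have "\<dots> \<le> kl_div x (y n)"
      using y(2)[of n] by (intro kl_div_ge_hellinger x y) (metis less_irrefl)
    finally show ?thesis .
  qed
  have "(\<lambda>n. (sqrt (x $ b) - sqrt (y n $ b))\<^sup>2) \<longlonglongrightarrow> 0"
    by (rule tendsto_sandwich[OF _ _ tendsto_const lim]) (auto simp: le)
  then have "(\<lambda>n. sqrt ((sqrt (x $ b) - sqrt (y n $ b))\<^sup>2)) \<longlonglongrightarrow> sqrt 0"
    by (rule tendsto_real_sqrt)
  then have "(\<lambda>n. sqrt (x $ b) - sqrt (y n $ b)) \<longlonglongrightarrow> 0"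
    by (simp add: tendsto_rabs_zero_iff)
  then have "(\<lambda>n. sqrt (x $ b) - (sqrt (x $ b) - sqrt (y n $ b))) \<longlonglongrightarrow> sqrt (x $ b) - 0"
    by (intro tendsto_intros)
  then have "(\<lambda>n. (sqrt (y n $ b))\<^sup>2) \<longlonglongrightarrow> (sqrt (x $ b))\<^sup>2"
    by (intro tendsto_power) simp
  then show "(\<lambda>n. y n $ b) \<longlonglongrightarrow> x $ b"
    using simplex_onD[OF x] simplex_onD[OF y(1)] by simp
qed

text \<open>Coordinates where \<open>x\<close> vanishes contribute zero for every \<open>n\<close>;
  on the others the ratio tends to one.\<close>

lemma tendsto_kl_div_self:
  fixes x :: "real ^ 'b"
  assumes lim: "y \<longlonglongrightarrow> x"
  shows "(\<lambda>n. kl_div x (y n)) \<longlonglongrightarrow> 0"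
proof -
  have "(\<lambda>n. x $ b * ln (x $ b / y n $ b)) \<longlonglongrightarrow> 0" for b
  proof (cases "x $ b = 0")
    case False
    have "(\<lambda>n. y n $ b) \<longlonglongrightarrow> x $ b" using lim by (rule tendsto_vec_nth)
    then have "(\<lambda>n. x $ b * ln (x $ b / y n $ b)) \<longlonglongrightarrow> x $ b * ln (x $ b / x $ b)"
      using False by (intro tendsto_mult[OF tendsto_const] tendsto_ln tendsto_divide) auto
    then show ?thesis using False by simp
  qed simp
  then show ?thesis unfolding kl_div_def by (auto intro: tendsto_null_sum)
qed

section \<open>EM iteration for mixture weights: ascent, rate and convergence\<close>

locale mixture =
  fixes p :: "'s::finite \<Rightarrow> real" and E :: "'s \<Rightarrow> 'b::finite \<Rightarrow> real"
  assumes p_pos: "\<And>s. 0 < p s" and p_sum: "(\<Sum>s\<in>UNIV. p s) = 1"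
    and E_pos: "\<And>s b. 0 < E s b"
begin

definition mix :: "real ^ 'b \<Rightarrow> 's \<Rightarrow> real" where
  "mix r s = (\<Sum>b\<in>UNIV. r $ b * E s b)"

definition loglik :: "real ^ 'b \<Rightarrow> real" where
  "loglik r = (\<Sum>s\<in>UNIV. p s * ln (mix r s))"

text \<open>The factor multiplying \<open>r $ b\<close> is the partial derivative of
  \<open>loglik\<close> at \<open>r\<close>. Equivalently, the step averages over \<open>s\<close>
  the posterior weights \<open>r $ b * E s b / mix r s\<close>, as \<open>em_step_alt\<close>
  states.\<close>

definition em_step :: "real ^ 'b \<Rightarrow> real ^ 'b" where
  "em_step r = (\<chi> b. r $ b * (\<Sum>s\<in>UNIV. p s * E s b / mix r s))"

lemma mix_pos:
  assumes r: "r \<in> simplex_on"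
  shows "0 < mix r s"
proof -
  obtain b where "r $ b \<noteq> 0"
    using simplex_onD(2)[OF r] by (metis sum.neutral zero_neq_one)
  then have "0 < r $ b * E s b"
    using simplex_onD(1)[OF r, of b] E_pos by (simp add: order_less_le)
  also have "\<dots> \<le> mix r s"
    unfolding mix_def
    by (rule member_le_sum)
      (auto intro!: mult_nonneg_nonneg simplex_onD[OF r] less_imp_le[OF E_pos])
  finally show ?thesis .
qed

lemma weights_sum:
  assumes r: "r \<in> simplex_on"
  shows "(\<Sum>b\<in>UNIV. r $ b * E s b / mix r s) = 1"
  using mix_pos[OF r, of s] by (simp add: mix_def flip: sum_divide_distrib)

lemma em_step_alt: "em_step r $ b = (\<Sum>s\<in>UNIV. p s * (r $ b * E s b / mix r s))"
  by (simp add: em_step_def sum_distrib_left algebra_simps)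

lemma em_step_in_simplex:
  assumes r: "r \<in> simplex_on"
  shows "em_step r \<in> simplex_on"
proof (rule simplex_onI)
  show "0 \<le> em_step r $ b" for b
    unfolding em_step_alt using simplex_onD[OF r]
    by (intro sum_nonneg mult_nonneg_nonneg divide_nonneg_nonneg less_imp_le[OF p_pos]
        less_imp_le[OF E_pos] less_imp_le[OF mix_pos[OF r]]) auto
  have "(\<Sum>b\<in>UNIV. em_step r $ b) = (\<Sum>s\<in>UNIV. p s * (\<Sum>b\<in>UNIV. r $ b * E s b / mix r s))"
    unfolding em_step_alt by (subst sum.swap) (simp add: sum_distrib_left)
  then show "(\<Sum>b\<in>UNIV. em_step r $ b) = 1" by (simp add: weights_sum[OF r] p_sum)
qed

lemma em_step_factor_pos:
  assumes r: "r \<in> simplex_on"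
  shows "0 < (\<Sum>s\<in>UNIV. p s * E s b / mix r s)"
  by (intro sum_pos divide_pos_pos mult_pos_pos p_pos E_pos mix_pos[OF r]) auto

lemma em_step_eq_0_iff:
  assumes r: "r \<in> simplex_on"
  shows "em_step r $ b = 0 \<longleftrightarrow> r $ b = 0"
  using em_step_factor_pos[OF r, of b] by (simp add: em_step_def)

text \<open>The usual EM argument: the posterior weights \<open>w\<close> at \<open>r\<close> give a
  Jensen lower bound for each \<open>ln (mix r' s)\<close>, and the average of these weights over
  \<open>s\<close> is the new point \<open>r'\<close>, which turns the gain into a
  divergence.\<close>

lemma loglik_em_step_ge:
  assumes r: "r \<in> simplex_on"
  shows "loglik r + kl_div (em_step r) r \<le> loglik (em_step r)"
proof -
  define r' where "r' = em_step r"
  define w where "w s b = r $ b * E s b / mix r s" for s b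
  have r': "r' \<in> simplex_on" unfolding r'_def by (rule em_step_in_simplex[OF r])
  have w0: "0 \<le> w s b" for s b
    unfolding w_def using simplex_onD[OF r] E_pos mix_pos[OF r]
    by (intro divide_nonneg_nonneg mult_nonneg_nonneg) (auto intro: less_imp_le)
  have zero: "r' $ b = 0 \<longleftrightarrow> r $ b = 0" for b
    unfolding r'_def by (rule em_step_eq_0_iff[OF r])
  have "- ln (mix r' s) \<le> - (\<Sum>b\<in>UNIV. w s b * ln (r' $ b / r $ b)) - ln (mix r s)" for s
  proof -
    \<comment> \<open>The weights \<open>w s\<close> have mass one and the reference terms have mass
      \<open>mix r' s\<close>, so the left side is \<open>- ln (mix r' s)\<close>.\<close>
    have "(\<Sum>b\<in>UNIV. w s b) * ln ((\<Sum>b\<in>UNIV. w s b) / (\<Sum>b\<in>UNIV. r' $ b * E s b))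
        \<le> (\<Sum>b\<in>UNIV. w s b * ln (w s b / (r' $ b * E s b)))"
    proof (rule log_sum_inequality)
      show "0 \<le> r' $ b * E s b" for b
        using simplex_onD[OF r'] E_pos by (simp add: less_imp_le)
      show "w s b = 0" if "r' $ b * E s b = 0" for b
        using that E_pos[of s b] by (simp add: zero w_def)
    qed (auto simp: w0)
    moreover have "(\<Sum>b\<in>UNIV. w s b) = 1" unfolding w_def by (rule weights_sum[OF r])
    moreover have "w s b * ln (w s b / (r' $ b * E s b))
        = - w s b * ln (r' $ b / r $ b) - w s b * ln (mix r s)" for b
    proof (cases "r $ b = 0")
      case False
      then have "0 < r $ b" "0 < r' $ b"
        using zero[of b] simplex_onD(1)[OF r, of b] simplex_onD(1)[OF r', of b]
        by (auto simp: order_less_le)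
      with E_pos[of s b] mix_pos[OF r, of s]
      have "ln (w s b / (r' $ b * E s b)) = - ln (r' $ b / r $ b) - ln (mix r s)"
        by (simp add: w_def ln_div ln_mult)
      then show ?thesis by (simp add: right_diff_distrib)
    qed (simp add: w_def)
    ultimately show ?thesis using mix_pos[OF r', of s]
      by (simp add: sum_subtractf sum_negf ln_div flip: sum_distrib_right mix_def)
  qed
  then have "(\<Sum>s\<in>UNIV. p s * (ln (mix r s) + (\<Sum>b\<in>UNIV. w s b * ln (r' $ b / r $ b))))
      \<le> loglik r'"
    unfolding loglik_def
    by (intro sum_mono mult_left_mono less_imp_le[OF p_pos]) (smt (verit))
  moreover have "(\<Sum>s\<in>UNIV. p s * (\<Sum>b\<in>UNIV. w s b * ln (r' $ b / r $ b))) = kl_div r' r"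
  proof -
    have "(\<Sum>s\<in>UNIV. p s * (\<Sum>b\<in>UNIV. w s b * ln (r' $ b / r $ b)))
        = (\<Sum>b\<in>UNIV. \<Sum>s\<in>UNIV. p s * w s b * ln (r' $ b / r $ b))"
      by (subst sum.swap) (simp add: sum_distrib_left mult.assoc)
    also have "\<dots> = (\<Sum>b\<in>UNIV. (\<Sum>s\<in>UNIV. p s * w s b) * ln (r' $ b / r $ b))"
      by (simp add: sum_distrib_right)
    also have "\<dots> = kl_div r' r" by (simp add: kl_div_def r'_def em_step_alt w_def)
    finally show ?thesis .
  qed
  ultimately show ?thesis
    by (simp add: distrib_left sum.distrib loglik_def r'_def)
qed

lemma em_step_kl_div_nonneg:
  assumes r: "r \<in> simplex_on"
  shows "0 \<le> kl_div (em_step r) r"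
  by (intro kl_div_nonneg em_step_in_simplex r) (simp add: em_step_eq_0_iff[OF r])

text \<open>A step from a maximizer cannot raise \<open>loglik\<close>, so the guaranteed gain is
  zero and the Hellinger bound forces both points to agree.\<close>

lemma maximizer_fixed:
  assumes m: "m \<in> simplex_on" and max: "\<And>x. x \<in> simplex_on \<Longrightarrow> loglik x \<le> loglik m"
  shows "em_step m = m"
proof -
  have "kl_div (em_step m) m \<le> 0"
    using loglik_em_step_ge[OF m] max[OF em_step_in_simplex[OF m]] by linarith
  then have "(\<Sum>b\<in>UNIV. (sqrt (em_step m $ b) - sqrt (m $ b))\<^sup>2) \<le> 0"
    using kl_div_ge_hellinger[OF em_step_in_simplex[OF m] m] em_step_eq_0_iff[OF m]
    by fastforce
  then have "(\<Sum>b\<in>UNIV. (sqrt (em_step m $ b) - sqrt (m $ b))\<^sup>2) = 0"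
    by (intro antisym sum_nonneg) auto
  then show ?thesis by (simp add: sum_nonneg_eq_0_iff vec_eq_iff)
qed

text \<open>With weights \<open>p s * m $ b * E s b / mix m s\<close>, whose sum over \<open>s\<close> is \<open>m $ b\<close> because
  \<open>m\<close> is fixed, this is Jensen's inequality for the logarithm of the factor by which the step
  multiplies \<open>r $ b\<close>.\<close>

lemma loglik_gap_le_kl_div_decrease:
  assumes m: "m \<in> simplex_on" and fixed: "em_step m = m"
    and r: "r \<in> simplex_on" and r_pos: "\<And>b. 0 < r $ b"
  shows "loglik m - loglik r \<le> kl_div m r - kl_div m (em_step r)"
proof -
  define \<rho> where "\<rho> b = (\<Sum>s\<in>UNIV. p s * E s b / mix r s)" for b
  define x where "x b s = p s * (m $ b * E s b / mix m s)" for b s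
  have \<rho>: "0 < \<rho> b" for b unfolding \<rho>_def by (rule em_step_factor_pos[OF r])
  have step: "em_step r $ b = r $ b * \<rho> b" for b by (simp add: em_step_def \<rho>_def)
  have x0: "0 \<le> x b s" for b s
    unfolding x_def using simplex_onD[OF m]
    by (intro mult_nonneg_nonneg divide_nonneg_nonneg less_imp_le[OF p_pos]
        less_imp_le[OF E_pos] less_imp_le[OF mix_pos[OF m]]) auto
  have sum_x: "(\<Sum>s\<in>UNIV. x b s) = m $ b" for b
    using em_step_alt[of m b] by (simp add: x_def fixed)
  have jensen: "(\<Sum>s\<in>UNIV. x b s * (ln (mix m s) - ln (mix r s))) \<le> m $ b * ln (\<rho> b)" for b
  proof -
    \<comment> \<open>Chosen so that \<open>x b s / ?y s\<close> is
      \<open>mix r s / mix m s\<close>, while the factor \<open>mix m s\<close> cancels in the sum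
      over \<open>s\<close>, leaving \<open>m $ b * \<rho> b\<close>.\<close>
    let ?y = "\<lambda>s. x b s * (mix m s / mix r s)"
    have "(\<Sum>s\<in>UNIV. x b s) * ln ((\<Sum>s\<in>UNIV. x b s) / (\<Sum>s\<in>UNIV. ?y s))
        \<le> (\<Sum>s\<in>UNIV. x b s * ln (x b s / ?y s))"
    proof (rule log_sum_inequality)
      show "0 \<le> ?y s" for s
        using x0[of b s] mix_pos[OF m, of s] mix_pos[OF r, of s] by simp
      show "x b s = 0" if "?y s = 0" for s
        using that mix_pos[OF m, of s] mix_pos[OF r, of s] by simp
    qed (auto simp: x0)
    moreover have "(\<Sum>s\<in>UNIV. ?y s) = m $ b * \<rho> b"
      unfolding \<rho>_def sum_distrib_left
    proof (rule sum.cong)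
      show "?y s = m $ b * (p s * E s b / mix r s)" for s
        using mix_pos[OF m, of s] by (simp add: x_def)
    qed simp
    moreover have "x b s * ln (x b s / ?y s) = - (x b s * (ln (mix m s) - ln (mix r s)))" for s
      using mix_pos[OF m, of s] mix_pos[OF r, of s]
      by (cases "x b s = 0") (auto simp: ln_div algebra_simps)
    moreover have "m $ b * ln (m $ b / (m $ b * \<rho> b)) = - (m $ b * ln (\<rho> b))"
      using \<rho>[of b] by (cases "m $ b = 0") (auto simp: ln_div)
    ultimately show ?thesis by (simp add: sum_x sum_negf)
  qed
  have "loglik m - loglik r = (\<Sum>s\<in>UNIV. p s * (ln (mix m s) - ln (mix r s)))"
    by (simp add: loglik_def right_diff_distrib sum_subtractf)
  \<comment> \<open>The posterior weights at \<open>m\<close> sum to one over \<open>b\<close>, so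
    \<open>p s\<close> splits into the \<open>x b s\<close>.\<close>
  also have "\<dots> = (\<Sum>s\<in>UNIV. (\<Sum>b\<in>UNIV. x b s) * (ln (mix m s) - ln (mix r s)))"
    by (simp only: x_def weights_sum[OF m] sum_distrib_left[symmetric] mult_1_right)
  also have "\<dots> = (\<Sum>b\<in>UNIV. \<Sum>s\<in>UNIV. x b s * (ln (mix m s) - ln (mix r s)))"
    by (subst sum.swap) (simp add: sum_distrib_right)
  also have "\<dots> \<le> (\<Sum>b\<in>UNIV. m $ b * ln (\<rho> b))"
    by (intro sum_mono jensen)
  \<comment> \<open>The step multiplies \<open>r $ b\<close> by \<open>\<rho> b\<close>, so the two
    divergences differ exactly by these logarithms.\<close>
  also have "\<dots> = kl_div m r - kl_div m (em_step r)"
    unfolding kl_div_def sum_subtractf[symmetric]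
  proof (rule sum.cong)
    show "m $ b * ln (\<rho> b) = m $ b * ln (m $ b / r $ b) - m $ b * ln (m $ b / em_step r $ b)" for b
      using r_pos[of b] \<rho>[of b] simplex_onD(1)[OF m, of b]
      by (cases "m $ b = 0") (auto simp: step ln_div ln_mult algebra_simps)
  qed simp
  finally show ?thesis .
qed

lemma continuous_on_mix: "continuous_on A (\<lambda>r. mix r s)"
  unfolding mix_def by (intro continuous_intros)

lemma continuous_on_loglik: "continuous_on simplex_on loglik"
  unfolding loglik_def
  by (intro continuous_intros continuous_on_mix) (use mix_pos in \<open>auto simp: less_imp_neq[symmetric]\<close>)

text \<open>Maximizers may be non-unique, so the limit is found in two stages: an arbitrary
  maximizer yields the limiting value of \<open>loglik\<close>, which shows that a cluster point is
  a maximizer too; the divergence from that point then controls the whole sequence.\<close>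

theorem em_iteration_convergence:
  fixes r :: "nat \<Rightarrow> real ^ 'b"
  assumes r0: "r 0 \<in> simplex_on" "\<And>b. 0 < r 0 $ b"
    and step: "\<And>n. r (Suc n) = em_step (r n)"
  obtains m where "m \<in> simplex_on" "em_step m = m" "r \<longlonglongrightarrow> m"
    "\<And>x. x \<in> simplex_on \<Longrightarrow> loglik x \<le> loglik m"
    "\<And>n. real (Suc n) * (loglik m - loglik (r n)) \<le> kl_div m (r 0)"
proof -
  have r: "r n \<in> simplex_on" for n
    by (induction n) (auto simp: r0 step em_step_in_simplex)
  have r_pos: "0 < r n $ b" for n b
  proof (induction n)
    case (Suc n)
    then show ?case using em_step_factor_pos[OF r] by (simp add: step em_step_def)
  qed (rule r0)
  have mono: "incseq (\<lambda>n. loglik (r n))"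
    using loglik_em_step_ge[OF r] em_step_kl_div_nonneg[OF r]
    by (intro incseq_SucI) (smt (verit) step)
  have kl_nonneg: "0 \<le> kl_div m (r n)" if "m \<in> simplex_on" for m n
    using r_pos[of n] by (intro kl_div_nonneg that r) (metis less_irrefl)
  have decrease: "loglik m - loglik (r n) \<le> kl_div m (r n) - kl_div m (r (Suc n))"
    if "m \<in> simplex_on" "\<And>x. x \<in> simplex_on \<Longrightarrow> loglik x \<le> loglik m" for m n
    unfolding step using that r r_pos
    by (intro loglik_gap_le_kl_div_decrease maximizer_fixed) auto
  have rate: "real (Suc n) * (loglik m - loglik (r n)) \<le> kl_div m (r 0)"
    if m: "m \<in> simplex_on" "\<And>x. x \<in> simplex_on \<Longrightarrow> loglik x \<le> loglik m" for m n
  proof -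
    have "real (Suc n) * (loglik m - loglik (r n)) = (\<Sum>k<Suc n. loglik m - loglik (r n))"
      by simp
    \<comment> \<open>The gaps are nonincreasing, so \<open>Suc n\<close> copies of the last are at
      most the sum of all of them.\<close>
    also have "\<dots> \<le> (\<Sum>k<Suc n. loglik m - loglik (r k))"
      using mono by (intro sum_mono diff_left_mono) (auto simp: incseq_def)
    also have "\<dots> \<le> (\<Sum>k<Suc n. kl_div m (r k) - kl_div m (r (Suc k)))"
      by (intro sum_mono decrease m)
    also have "\<dots> = kl_div m (r 0) - kl_div m (r (Suc n))"
      by (rule sum_lessThan_telescope')
    also have "\<dots> \<le> kl_div m (r 0)"
      using kl_nonneg[OF m(1)] by simp
    finally show ?thesis .
  qed
  obtain m0 where m0: "m0 \<in> simplex_on" "\<And>x. x \<in> simplex_on \<Longrightarrow> loglik x \<le> loglik m0"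
    using continuous_attains_sup[OF compact_simplex_on _ continuous_on_loglik] r0(1) by blast
  obtain m \<sigma> where m: "m \<in> simplex_on" and \<sigma>: "strict_mono \<sigma>" "(r \<circ> \<sigma>) \<longlonglongrightarrow> m"
    using compact_simplex_on r unfolding compact_def by metis
  have bound: "(\<lambda>n. kl_div m0 (r 0) / real (Suc n)) \<longlonglongrightarrow> 0"
    by (rule LIMSEQ_Suc[OF lim_const_over_n])
  have "(\<lambda>n. loglik m0 - loglik (r n)) \<longlonglongrightarrow> 0"
  proof (rule tendsto_sandwich[OF _ _ tendsto_const bound])
    show "\<forall>\<^sub>F n in sequentially. 0 \<le> loglik m0 - loglik (r n)"
      using m0(2)[OF r] by simp
    show "\<forall>\<^sub>F n in sequentially. loglik m0 - loglik (r n) \<le> kl_div m0 (r 0) / real (Suc n)"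
      using rate[OF m0] by (auto simp: pos_le_divide_eq mult.commute simp del: of_nat_Suc)
  qed
  then have "(\<lambda>n. loglik m0 - (loglik m0 - loglik (r n))) \<longlonglongrightarrow> loglik m0 - 0"
    by (intro tendsto_intros)
  then have "(\<lambda>n. loglik (r n)) \<longlonglongrightarrow> loglik m0" by simp
  then have "(\<lambda>n. loglik ((r \<circ> \<sigma>) n)) \<longlonglongrightarrow> loglik m0"
    using LIMSEQ_subseq_LIMSEQ[OF _ \<sigma>(1)] by (fastforce simp: o_def)
  moreover have "(\<lambda>n. loglik ((r \<circ> \<sigma>) n)) \<longlonglongrightarrow> loglik m"
    by (rule continuous_on_tendsto_compose[OF continuous_on_loglik \<sigma>(2) m]) (simp add: r)
  ultimately have "loglik m = loglik m0" by (rule LIMSEQ_unique[symmetric])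
  with m0(2) have max: "\<And>x. x \<in> simplex_on \<Longrightarrow> loglik x \<le> loglik m" by simp
  \<comment> \<open>The divergence from \<open>m\<close> decreases and hence converges; its limit
    can be read off along the subsequence tending to \<open>m\<close>.\<close>
  have dec: "decseq (\<lambda>n. kl_div m (r n))"
    using decrease[OF m max] max[OF r] by (intro decseq_SucI) (smt (verit))
  then obtain L where L: "(\<lambda>n. kl_div m (r n)) \<longlonglongrightarrow> L"
    using decseq_convergent[OF dec, of 0] kl_nonneg[OF m] by blast
  then have "(\<lambda>n. kl_div m ((r \<circ> \<sigma>) n)) \<longlonglongrightarrow> L"
    using LIMSEQ_subseq_LIMSEQ[OF _ \<sigma>(1)] by (fastforce simp: o_def)
  with tendsto_kl_div_self[OF \<sigma>(2)] have "L = 0" by (rule LIMSEQ_unique[symmetric])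
  with L have "r \<longlonglongrightarrow> m"
    by (intro kl_div_tendsto_0_imp_tendsto m r r_pos) simp
  with m max show ?thesis
    by (intro that[of m] maximizer_fixed rate)
qed

end

section \<open>Marginals and the Lagrangian as a free energy\<close>

definition free_energy ::
  "('s::finite \<Rightarrow> real) \<Rightarrow> ('a::finite \<Rightarrow> 'b::finite \<Rightarrow> 's \<Rightarrow> real)
    \<Rightarrow> real \<Rightarrow> real ^ ('a \<times> 'b) ^ 's \<Rightarrow> real ^ 'b \<Rightarrow> real" where
  "free_energy p c lam q r = (\<Sum>s\<in>UNIV. p s * (\<Sum>a\<in>UNIV. \<Sum>b\<in>UNIV.
     q $ s $ (a, b) * ln (q $ s $ (a, b) / (r $ b * exp (- c a b s / lam)))))"

lemma simplex_familyD:
  assumes "q \<in> simplex_family"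
  shows "0 \<le> q $ s $ (a, b)" "(\<Sum>a\<in>UNIV. \<Sum>b\<in>UNIV. q $ s $ (a, b)) = 1"
  using assms
  by (auto simp: simplex_family_def simplex_onD sum.cartesian_product dest!: spec[of _ s])

text \<open>Isolates one nonnegative summand of the marginal. Consequently \<open>q\<close> vanishes
  wherever its marginal does, and logarithms with nonzero coefficient have positive
  arguments.\<close>

lemma T_map_ge:
  assumes p: "\<And>s. 0 < p s" and q: "q \<in> simplex_family"
  shows "p s * q $ s $ (a, b) \<le> T_map p q $ b"
proof -
  have "q $ s $ (a, b) \<le> (\<Sum>a\<in>UNIV. q $ s $ (a, b))"
    by (rule member_le_sum) (auto simp: simplex_familyD(1)[OF q])
  then have "p s * q $ s $ (a, b) \<le> p s * (\<Sum>a\<in>UNIV. q $ s $ (a, b))"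
    using p[of s] by (intro mult_left_mono) auto
  also have "\<dots> \<le> (\<Sum>s\<in>UNIV. p s * (\<Sum>a\<in>UNIV. q $ s $ (a, b)))"
    by (rule member_le_sum[where f = "\<lambda>s. p s * (\<Sum>a\<in>UNIV. q $ s $ (a, b))"])
      (auto intro!: mult_nonneg_nonneg sum_nonneg simplex_familyD(1)[OF q] less_imp_le[OF p])
  finally show ?thesis by (simp add: T_map_def)
qed

lemma T_map_pos:
  assumes "\<And>s. 0 < p s" "q \<in> simplex_family" "0 < q $ s $ (a, b)"
  shows "0 < T_map p q $ b"
  using T_map_ge[where p = p, OF assms(1,2), of s a b] assms(1)[of s] assms(3)
  by (smt (verit) mult_pos_pos)

lemma T_map_in_simplex:
  assumes p: "\<And>s. 0 < p s" "(\<Sum>s\<in>UNIV. p s) = 1" and q: "q \<in> simplex_family"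
  shows "T_map p q \<in> simplex_on"
proof (rule simplex_onI)
  show "0 \<le> T_map p q $ b" for b
    by (auto simp: T_map_def
        intro!: mult_nonneg_nonneg sum_nonneg simplex_familyD(1)[OF q] less_imp_le[OF p(1)])
  have swap: "(\<Sum>b\<in>UNIV. \<Sum>a\<in>UNIV. q $ s $ (a, b)) = (\<Sum>a\<in>UNIV. \<Sum>b\<in>UNIV. q $ s $ (a, b))"
    for s by (rule sum.swap)
  have "(\<Sum>b\<in>UNIV. T_map p q $ b)
      = (\<Sum>s\<in>UNIV. \<Sum>b\<in>UNIV. p s * (\<Sum>a\<in>UNIV. q $ s $ (a, b)))"
    by (simp add: T_map_def) (rule sum.swap)
  also have "\<dots> = (\<Sum>s\<in>UNIV. p s * (\<Sum>a\<in>UNIV. \<Sum>b\<in>UNIV. q $ s $ (a, b)))"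
    by (simp only: sum_distrib_left[symmetric] swap)
  finally show "(\<Sum>b\<in>UNIV. T_map p q $ b) = 1"
    by (simp add: simplex_familyD(2)[OF q] p)
qed

lemma T_map_eq_marginal:
  "T_map p q $ b = (\<Sum>a\<in>UNIV. \<Sum>s\<in>UNIV. p s * q $ s $ (a, b))"
  by (simp add: T_map_def sum_distrib_left) (rule sum.swap)

text \<open>On nonzero entries, putting \<open>exp (- c a b s / lam)\<close> into the denominator
  adds \<open>c a b s / lam\<close> to the logarithm, which accounts for the linear cost; zero
  entries contribute nothing to either side.\<close>

lemma lagrangian_eq_free_energy:
  fixes q :: "real ^ ('a::finite \<times> 'b::finite) ^ 's::finite"
  assumes p: "\<And>s. 0 < p s" and lam: "0 < lam" and q: "q \<in> simplex_family"
  shows "lagrangian p c q lam = ereal (lam * free_energy p c lam q (T_map p q))"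
proof -
  have nn: "0 \<le> q $ s $ (a, b)" for s a b by (rule simplex_familyD(1)[OF q])
  have Tnn: "0 \<le> T_map p q $ b" for b
    using T_map_ge[where p = p, OF p q] nn p by (meson less_imp_le mult_nonneg_nonneg order_trans)
  have psi: "psi (q $ s $ (a, b)) (T_map p q $ b)
      = ereal (q $ s $ (a, b) * ln (q $ s $ (a, b) / T_map p q $ b))" for s a b
    using nn[of s a b] Tnn[of b] T_map_pos[where p = p, OF p q, of s a b]
    by (cases "q $ s $ (a, b) = 0") (auto simp: psi_def zero_ereal_def)
  have "g_fun p q = ereal (\<Sum>s\<in>UNIV. p s * (\<Sum>a\<in>UNIV. \<Sum>b\<in>UNIV.
      q $ s $ (a, b) * ln (q $ s $ (a, b) / T_map p q $ b)))"
    using nn unfolding g_fun_def T_map_eq_marginal[symmetric] psi by simp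
  moreover have "lam * (q $ s $ (a, b) * ln (q $ s $ (a, b) / (T_map p q $ b * exp (- c a b s / lam))))
      = c a b s * q $ s $ (a, b) + lam * (q $ s $ (a, b) * ln (q $ s $ (a, b) / T_map p q $ b))"
    for s a b
  proof (cases "q $ s $ (a, b) = 0")
    case False
    then have "0 < q $ s $ (a, b)" using nn[of s a b] by simp
    with T_map_pos[where p = p, OF p q this] lam show ?thesis
      by (simp add: ln_div ln_mult field_simps)
  qed simp
  then have "lam * free_energy p c lam q (T_map p q)
      = (\<Sum>s\<in>UNIV. p s * (\<Sum>a\<in>UNIV. \<Sum>b\<in>UNIV. c a b s * q $ s $ (a, b)))
        + lam * (\<Sum>s\<in>UNIV. p s * (\<Sum>a\<in>UNIV. \<Sum>b\<in>UNIV.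
            q $ s $ (a, b) * ln (q $ s $ (a, b) / T_map p q $ b)))"
    by (simp add: free_energy_def sum_distrib_left sum.distrib distrib_left mult.left_commute[of lam])
  ultimately show ?thesis by (simp add: lagrangian_def)
qed

section \<open>Transfer from marginals to the full iteration\<close>

theorem theorem5p1:
  fixes p :: "'s::finite \<Rightarrow> real"
    and c :: "'a::finite \<Rightarrow> 'b::finite \<Rightarrow> 's \<Rightarrow> real"
    and lam :: real
    and q :: "nat \<Rightarrow> real ^ ('a \<times> 'b) ^ 's"
  assumes card_A: "CARD('a) \<ge> 2"
    and p_pos: "\<And>s. p s > 0"
    and p_sum: "(\<Sum>s\<in>UNIV. p s) = 1"
    and c_min0: "\<And>s. cost_min_at c s = 0"
    and c_max: "cost_max p c > cost_min p c"
    and lam_pos: "lam > 0"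
    and q0: "q 0 \<in> rel_interior simplex_family"
    and q_rec: "\<And>n s a b. q (Suc n) $ s $ (a, b) =
      (T_map p (q n) $ b * exp (- c a b s / lam)) /
      (\<Sum>a'\<in>UNIV. \<Sum>b'\<in>UNIV. T_map p (q n) $ b' * exp (- c a' b' s / lam))"
  shows "\<exists>qbar \<in> minimizers p c lam.
    q \<longlonglongrightarrow> qbar \<and>
    (\<lambda>n. real_of_ereal (lagrangian p c (q n) lam) - real_of_ereal (lagrangian p c qbar lam))
      \<in> O(\<lambda>n. 1 / real n)"
proof -
  \<comment> \<open>Marginals only see \<open>b\<close>, so the Boltzmann factors are summed over
    \<open>a\<close>.\<close>
  define E where "E s b = (\<Sum>a\<in>UNIV. exp (- c a b s / lam))" for s b
  interpret mixture p E
    by unfold_locales (auto simp: E_def p_pos p_sum intro!: sum_pos)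
  \<comment> \<open>The right-hand side of the recurrence as a function of the marginal
    alone.\<close>
  define gibbs :: "real ^ 'b \<Rightarrow> real ^ ('a \<times> 'b) ^ 's" where
    "gibbs r = (\<chi> s i. r $ snd i * exp (- c (fst i) (snd i) s / lam) / mix r s)" for r
  have mix_eq: "mix r s = (\<Sum>a\<in>UNIV. \<Sum>b\<in>UNIV. r $ b * exp (- c a b s / lam))" for r s
    unfolding mix_def E_def sum_distrib_left by (rule sum.swap)
  have gibbs_nth: "gibbs r $ s $ (a, b) = r $ b * exp (- c a b s / lam) / mix r s" for r s a b
    by (simp add: gibbs_def)
  have q_Suc: "q (Suc n) = gibbs (T_map p (q n))" for n
    by (auto simp: vec_eq_iff gibbs_nth q_rec mix_eq)
  have gibbs_feasible: "gibbs r \<in> simplex_family" if r: "r \<in> simplex_on" for r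
  proof -
    have "gibbs r $ s \<in> simplex_on" for s
    proof (rule simplex_onI)
      show "0 \<le> gibbs r $ s $ i" for i
        using simplex_onD(1)[OF r] mix_pos[OF r, of s] by (simp add: gibbs_def)
      have "(\<Sum>i\<in>UNIV. gibbs r $ s $ i) = (\<Sum>a\<in>UNIV. \<Sum>b\<in>UNIV. gibbs r $ s $ (a, b))"
        by (simp add: sum.cartesian_product)
      also have "\<dots> = mix r s / mix r s"
        by (simp add: gibbs_nth mix_eq flip: sum_divide_distrib)
      finally show "(\<Sum>i\<in>UNIV. gibbs r $ s $ i) = 1"
        using mix_pos[OF r, of s] by simp
    qed
    then show ?thesis by (simp add: simplex_family_def)
  qed
  have T_gibbs: "T_map p (gibbs r) = em_step r" for r
    by (simp add: vec_eq_iff em_step_alt T_map_def gibbs_nth E_def sum_distrib_left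
        sum_divide_distrib)
  \<comment> \<open>Log-sum inequality over pairs: \<open>x $ s\<close> has mass one and its
    reference weights have mass \<open>mix ?r s\<close>.\<close>
  have energy_ge: "- loglik (T_map p x) \<le> free_energy p c lam x (T_map p x)"
    if x: "x \<in> simplex_family" for x :: "real ^ ('a \<times> 'b) ^ 's"
  proof -
    let ?r = "T_map p x"
    have r: "?r \<in> simplex_on" by (rule T_map_in_simplex[OF p_pos p_sum x])
    have "- ln (mix ?r s) \<le> (\<Sum>a\<in>UNIV. \<Sum>b\<in>UNIV.
        x $ s $ (a, b) * ln (x $ s $ (a, b) / (?r $ b * exp (- c a b s / lam))))" for s
    proof -
      let ?x = "\<lambda>i. x $ s $ i" and ?y = "\<lambda>i. ?r $ snd i * exp (- c (fst i) (snd i) s / lam)"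
      have "sum ?x UNIV * ln (sum ?x UNIV / sum ?y UNIV) \<le> (\<Sum>i\<in>UNIV. ?x i * ln (?x i / ?y i))"
      proof (rule log_sum_inequality)
        show "0 \<le> ?x i" for i using simplex_familyD(1)[OF x] by (cases i) auto
        show "0 \<le> ?y i" for i using simplex_onD(1)[OF r] by simp
        show "?x i = 0" if "?y i = 0" for i
          using that T_map_pos[where p = p, OF p_pos x, of s "fst i" "snd i"]
            simplex_familyD(1)[OF x, of s "fst i" "snd i"] by fastforce
      qed simp
      moreover have "sum ?x UNIV = 1"
        using simplex_familyD(2)[OF x, of s] by (simp add: sum.cartesian_product)
      moreover have "sum ?y UNIV = mix ?r s"
        by (simp add: mix_eq sum.cartesian_product case_prod_unfold)
      moreover have "ln (1 / mix ?r s) = - ln (mix ?r s)"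
        using mix_pos[OF r, of s] by (simp add: ln_div)
      ultimately show ?thesis
        by (simp add: sum.cartesian_product case_prod_unfold)
    qed
    then have "(\<Sum>s\<in>UNIV. p s * - ln (mix ?r s)) \<le> free_energy p c lam x ?r"
      unfolding free_energy_def by (intro sum_mono mult_left_mono less_imp_le[OF p_pos])
    then show ?thesis by (simp add: loglik_def sum_negf)
  qed
  \<comment> \<open>Taking the new marginal \<open>em_step r\<close> as reference instead of
    \<open>r\<close> is what subtracts the divergence; at a fixed point it vanishes.\<close>
  have energy_gibbs: "free_energy p c lam (gibbs r) (em_step r) = - loglik r - kl_div (em_step r) r"
    if r: "r \<in> simplex_on" for r
  proof -
    let ?k = "\<lambda>b. ln (em_step r $ b / r $ b)"
    have "gibbs r $ s $ (a, b) * ln (gibbs r $ s $ (a, b) / (em_step r $ b * exp (- c a b s / lam)))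
        = - (gibbs r $ s $ (a, b) * ln (mix r s)) - gibbs r $ s $ (a, b) * ?k b" for s a b
    proof (cases "r $ b = 0")
      case False
      then have "0 < r $ b" "0 < em_step r $ b"
        using em_step_eq_0_iff[OF r, of b] simplex_onD(1)[OF r, of b]
          simplex_onD(1)[OF em_step_in_simplex[OF r], of b]
        by (auto simp: order_less_le)
      with mix_pos[OF r, of s]
      have "ln (gibbs r $ s $ (a, b) / (em_step r $ b * exp (- c a b s / lam)))
          = - ln (mix r s) - ?k b"
        by (simp add: gibbs_nth ln_div ln_mult)
      then show ?thesis by (simp add: right_diff_distrib)
    qed (simp add: gibbs_nth)
    then have "free_energy p c lam (gibbs r) (em_step r)
        = - (\<Sum>s\<in>UNIV. p s * ((\<Sum>a\<in>UNIV. \<Sum>b\<in>UNIV. gibbs r $ s $ (a, b)) * ln (mix r s)))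
          - (\<Sum>s\<in>UNIV. p s * (\<Sum>a\<in>UNIV. \<Sum>b\<in>UNIV. gibbs r $ s $ (a, b) * ?k b))"
      by (simp add: free_energy_def sum_subtractf sum_negf right_diff_distrib sum_distrib_right)
    also have "(\<Sum>s\<in>UNIV. p s * ((\<Sum>a\<in>UNIV. \<Sum>b\<in>UNIV. gibbs r $ s $ (a, b)) * ln (mix r s)))
        = loglik r"
      by (simp add: simplex_familyD(2)[OF gibbs_feasible[OF r]] loglik_def)
    also have "(\<Sum>s\<in>UNIV. p s * (\<Sum>a\<in>UNIV. \<Sum>b\<in>UNIV. gibbs r $ s $ (a, b) * ?k b))
        = (\<Sum>s\<in>UNIV. \<Sum>b\<in>UNIV. p s * (\<Sum>a\<in>UNIV. gibbs r $ s $ (a, b)) * ?k b)"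
      by (subst sum.swap) (simp add: sum_distrib_left sum_distrib_right mult.assoc)
    also have "\<dots> = (\<Sum>b\<in>UNIV. T_map p (gibbs r) $ b * ?k b)"
      by (subst sum.swap) (simp add: T_map_def sum_distrib_right)
    also have "\<dots> = kl_div (em_step r) r" by (simp add: T_gibbs kl_div_def)
    finally show ?thesis .
  qed
  define r where "r n = T_map p (q n)" for n
  have q0_feasible: "q 0 \<in> simplex_family" using q0 rel_interior_subset by blast
  have r_Suc: "r (Suc n) = em_step (r n)" for n by (simp add: r_def q_Suc T_gibbs)
  \<comment> \<open>The relative interior assumption enters here: all entries of \<open>q 0\<close>
    are positive, hence so are its marginals.\<close>
  have r0: "r 0 \<in> simplex_on" "0 < r 0 $ b" for b
    unfolding r_def
    by (auto intro!: T_map_in_simplex T_map_pos p_pos p_sum q0_feasible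
        rel_interior_simplex_family_pos q0)
  have r: "r n \<in> simplex_on" for n
    by (induction n) (auto simp: r0 r_Suc em_step_in_simplex)
  obtain m where m: "m \<in> simplex_on" and fixed: "em_step m = m" and lim: "r \<longlonglongrightarrow> m"
    and max: "\<And>x. x \<in> simplex_on \<Longrightarrow> loglik x \<le> loglik m"
    and rate: "\<And>n. real (Suc n) * (loglik m - loglik (r n)) \<le> kl_div m (r 0)"
    using em_iteration_convergence[of r] r0 r_Suc by blast
  have lag_bar: "lagrangian p c (gibbs m) lam = ereal (lam * (- loglik m))"
    using energy_gibbs[OF m] fixed
    by (simp add: lagrangian_eq_free_energy[OF p_pos lam_pos gibbs_feasible[OF m]] T_gibbs
        kl_div_self)
  \<comment> \<open>Together with \<open>lag_bar\<close> this proves optimality: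
    \<open>energy_ge\<close> bounds each value by its own marginal's likelihood, which is at most
    that of \<open>m\<close>.\<close>
  have bar_le: "lam * (- loglik m) \<le> lam * free_energy p c lam x (T_map p x)"
    if "x \<in> simplex_family" for x :: "real ^ ('a \<times> 'b) ^ 's"
    using energy_ge[OF that] max[OF T_map_in_simplex[OF p_pos p_sum that]] lam_pos
    by (intro mult_left_mono) auto
  have "gibbs m \<in> minimizers p c lam"
    unfolding minimizers_def is_arg_min_linorder
    using gibbs_feasible[OF m] bar_le
    by (auto simp: lag_bar lagrangian_eq_free_energy[OF p_pos lam_pos])
  moreover have "q \<longlonglongrightarrow> gibbs m"
  proof -
    have "(\<lambda>n. mix (r n) s) \<longlonglongrightarrow> mix m s" for s
      unfolding mix_def by (intro tendsto_intros lim)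
    then have "(\<lambda>n. gibbs (r n)) \<longlonglongrightarrow> gibbs m"
      unfolding gibbs_def using mix_pos[OF m]
      by (intro vec_tendstoI) (auto intro!: tendsto_intros lim simp: less_imp_neq[symmetric])
    \<comment> \<open>Only terms from index one on are of the form \<open>gibbs (r n)\<close>; the
      shift leaves the limit unchanged.\<close>
    then have "(\<lambda>n. q (Suc n)) \<longlonglongrightarrow> gibbs m" by (simp add: q_Suc r_def)
    then show ?thesis by (simp add: filterlim_sequentially_Suc)
  qed
  moreover have "(\<lambda>n. real_of_ereal (lagrangian p c (q n) lam)
      - real_of_ereal (lagrangian p c (gibbs m) lam)) \<in> O(\<lambda>n. 1 / real n)"
  proof (rule bigoI[where c = "lam * kl_div m (r 0)"])
    have "norm (real_of_ereal (lagrangian p c (q n) lam)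
        - real_of_ereal (lagrangian p c (gibbs m) lam)) \<le> lam * kl_div m (r 0) * norm (1 / real n)"
      if n: "n \<ge> 1" for n
    proof -
      \<comment> \<open>The iterate \<open>q n\<close> is produced by the marginal
        \<open>r k\<close> with \<open>n = Suc k\<close>, so the rate factor \<open>Suc k\<close> is
        exactly \<open>n\<close>.\<close>
      obtain k where k: "n = Suc k" using n by (cases n) auto
      have feas: "q n \<in> simplex_family"
        using gibbs_feasible[OF r[of k]] by (simp add: k q_Suc r_def)
      let ?F = "free_energy p c lam (q n) (T_map p (q n))"
      have "?F = - loglik (r k) - kl_div (em_step (r k)) (r k)"
        using energy_gibbs[OF r[of k]] by (simp add: k q_Suc T_gibbs r_def)
      then have "?F + loglik m \<le> loglik m - loglik (r k)"
        using em_step_kl_div_nonneg[OF r[of k]] by simp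
      also have "\<dots> \<le> kl_div m (r 0) / real n"
        using rate[of k] by (simp add: k pos_le_divide_eq mult.commute del: of_nat_Suc)
      finally have "lam * (?F + loglik m) \<le> lam * (kl_div m (r 0) / real n)"
        using lam_pos by (intro mult_left_mono) auto
      \<comment> \<open>Minimality of \<open>gibbs m\<close> makes the gap nonnegative, so its norm
        is the gap itself.\<close>
      moreover have "0 \<le> lam * (?F + loglik m)"
        using bar_le[OF feas] by (simp add: algebra_simps)
      ultimately show ?thesis
        by (simp add: lag_bar lagrangian_eq_free_energy[OF p_pos lam_pos feas] algebra_simps)
    qed
    then show "\<forall>\<^sub>F n in sequentially. norm (real_of_ereal (lagrangian p c (q n) lam)
        - real_of_ereal (lagrangian p c (gibbs m) lam)) \<le> lam * kl_div m (r 0) * norm (1 / real n)"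
      by (auto simp: eventually_at_top_linorder)
  qed
  ultimately show ?thesis by blast
qed

end
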